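(* Let $p,q\ge1$ be integers and $\sigma_1,\sigma_2\in\{\pm1\}$ with $(q,\sigma_2)\ne(1,1)$. The linear Euler $R$-sums $R_{p,q}^{\sigma_1,\sigma_2}$ are expressible in terms of colored multiple zeta values of weight $p+q$ and level four: \begin{align*} R_{p,q}^{\sigma_1,\sigma_2}=2^{p+q-2}\sigma_1\sigma_2^{3/2}\big\{ &L_4(q,p;\lambda_{\sigma_2},\lambda_{\sigma_1})+L_4(q,p;\lambda_{\sigma_2},\lambda_{\sigma_1}+2)\\ &-L_4(q,p;\lambda_{\sigma_2}+2,\lambda_{\sigma_1})-L_4(q,p;\lambda_{\sigma_2}+2,\lambda_{\sigma_1}+2)\big\}, \end{align*} where $\lambda_{\sigma}=0$ if $\sigma=1$ and $\lambda_{\sigma}=1$ if $\sigma=-1$. In case $q=1$ and $\sigma_2=-1$ the double series are understood as limits of partial sums over the outer index.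
   Context: For $\sigma\in\{\pm1\}$, $n\ge0$, $r\ge1$: $H_n^{(r)}(\sigma)=\sum_{k=1}^n\frac{\sigma^{k-1}}{k^r}$. The linear Euler $R$-sums are $R_{p,q}^{\sigma_1,\sigma_2}=\sum_{n\ge1}\sigma_2^{n-1}\frac{H_{n-1}^{(p)}(\sigma_1)}{(n-1/2)^q}$. With $\omega=\exp(2\pi\mathrm{i}/4)=\mathrm{i}$, $L_4(s_1,s_2;r_1,r_2)=\sum_{n_1>n_2\ge1}\frac{\omega^{r_1n_1}\omega^{r_2n_2}}{n_1^{s_1}n_2^{s_2}}$ denotes the colored multiple zeta values of level four (with $(s_1,\omega^{r_1})\ne(1,1)$). The powers are taken with $\sigma=\exp(\lambda_\sigma\pi\mathrm{i})$, i.e. $\sigma^{3/2}=\exp(3\lambda_\sigma\pi\mathrm{i}/2)$, so $1^{3/2}=1$ and $(-1)^{3/2}=-\mathrm{i}$. *)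

theory Defs
  imports "HOL-Analysis.Analysis"
begin

text \<open>The signs are real numbers; all notions below are only meant for the values 1 and -1.\<close>

definition alt_harm :: "nat \<Rightarrow> nat \<Rightarrow> real \<Rightarrow> real" where
  "alt_harm r n \<sigma> = (\<Sum>k=1..n. \<sigma> ^ (k - 1) / real k ^ r)"

definition euler_R_term :: "nat \<Rightarrow> nat \<Rightarrow> real \<Rightarrow> real \<Rightarrow> nat \<Rightarrow> real" where
  "euler_R_term p q \<sigma>1 \<sigma>2 n = \<sigma>2 ^ (n - 1) * alt_harm p (n - 1) \<sigma>1 / (real n - 1 / 2) ^ q"

text \<open>Series over \<open>n \<ge> 1\<close> are written as series over \<open>Suc n\<close>; \<^const>\<open>suminf\<close> is the limit of the
  partial sums, so conditionally convergent series are covered.\<close>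

definition euler_R :: "nat \<Rightarrow> nat \<Rightarrow> real \<Rightarrow> real \<Rightarrow> real" where
  "euler_R p q \<sigma>1 \<sigma>2 = (\<Sum>n. euler_R_term p q \<sigma>1 \<sigma>2 (Suc n))"

definition omega4 :: complex where
  "omega4 = exp (2 * of_real pi * \<i> / 4)"

text \<open>The double series over \<open>n1 > n2 \<ge> 1\<close> is the limit of its partial sums over the outer index
  \<open>n1\<close>. For \<open>s1 \<ge> 2\<close> (and \<open>s2 \<ge> 1\<close>) it converges absolutely and the order of summation is
  irrelevant; for \<open>s1 = 1\<close> it requires \<open>omega4 ^ r1 \<noteq> 1\<close>.\<close>

definition L4_term :: "nat \<Rightarrow> nat \<Rightarrow> nat \<Rightarrow> nat \<Rightarrow> nat \<Rightarrow> complex" where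
  "L4_term s1 s2 r1 r2 n1 =
     (\<Sum>n2 = 1..<n1. omega4 ^ (r1 * n1) * omega4 ^ (r2 * n2) / (of_nat n1 ^ s1 * of_nat n2 ^ s2))"

definition L4 :: "nat \<Rightarrow> nat \<Rightarrow> nat \<Rightarrow> nat \<Rightarrow> complex" where
  "L4 s1 s2 r1 r2 = (\<Sum>n. L4_term s1 s2 r1 r2 (Suc n))"

definition sign_exp :: "real \<Rightarrow> nat" where
  "sign_exp \<sigma> = (if \<sigma> = 1 then 0 else 1)"

text \<open>The branch of \<open>\<sigma>\<close> to the power 3/2 given by writing \<open>\<sigma> = exp (sign_exp \<sigma> * pi * \<i>)\<close>;
  its value at -1 is \<open>- \<i>\<close>.\<close>

definition sign_pow_3_2 :: "real \<Rightarrow> complex" where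
  "sign_pow_3_2 \<sigma> = exp (3 * of_nat (sign_exp \<sigma>) * of_real pi * \<i> / 2)"

end

theory Submission
  imports Defs
begin

text \<open>In the given combination of four values the \<open>(n1, n2)\<close> terms carry the factor
  \<open>(1 - (-1) ^ n1) * (1 + (-1) ^ n2)\<close>, so only odd \<open>n1 = 2 * n - 1\<close> and even \<open>n2 = 2 * k\<close>
  survive, and these are the terms of the Euler \<open>R\<close>-sum up to powers of 2 and signs.
  For convergence, the inner sums are \<open>O(sqrt n)\<close>; this suffices for \<open>s1 \<ge> 2\<close>, and for
  \<open>s1 = 1\<close> one sums by parts against the powers of a unit different from 1.\<close>

section \<open>Convergence of the double series with unimodular coefficients\<close>

definition polylog_partial :: "nat \<Rightarrow> complex \<Rightarrow> nat \<Rightarrow> complex" where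
  "polylog_partial p w n = (\<Sum>k = 1..<n. w ^ k / of_nat k ^ p)"

lemma polylog_partial_Suc:
  "n \<ge> 1 \<Longrightarrow> polylog_partial p w (Suc n) = polylog_partial p w n + w ^ n / of_nat n ^ p"
  by (simp add: polylog_partial_def)

text \<open>Telescoping, with s and t the square roots of n + 1 and n: 1/s^2 \<le> 1/s \<le> 2/(s +
  t) = 2(s - t). This is cruder than a logarithm, but dividing by n^2 still leaves the summable
  order n^(-3/2).\<close>

lemma sum_inverse_le_sqrt: "(\<Sum>k = 1..n. 1 / real k) \<le> 2 * sqrt (real n)"
proof (induction n)
  case (Suc n)
  define s t where "s = sqrt (real (Suc n))" and "t = sqrt (real n)"
  have st: "s \<ge> 1" "t \<ge> 0" "t \<le> s" "s ^ 2 = real (Suc n)" "s ^ 2 - t ^ 2 = 1"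
    by (auto simp: s_def t_def)
  have "1 / real (Suc n) \<le> 1 / s"
    unfolding st(4) [symmetric] using st(1)
    by (intro divide_left_mono self_le_power) auto
  also have "\<dots> \<le> 2 / (s + t)"
    using st by (simp add: field_simps)
  also have "\<dots> = 2 * (s - t)"
  proof -
    have "(s - t) * (s + t) = 1" using st(5) by (simp add: algebra_simps power2_eq_square)
    thus ?thesis using st(1,2) by (simp add: field_simps)
  qed
  finally have "1 / real (Suc n) \<le> 2 * sqrt (real (Suc n)) - 2 * sqrt (real n)"
    by (simp add: s_def t_def)
  with Suc show ?case by simp
qed simp

lemma norm_polylog_partial_le:
  assumes "norm w = 1" "p \<ge> 1"
  shows "norm (polylog_partial p w n) \<le> 2 * sqrt (real n)"
proof -
  have "norm (polylog_partial p w n) \<le> (\<Sum>k = 1..<n. norm (w ^ k / of_nat k ^ p))"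
    unfolding polylog_partial_def by (rule norm_sum)
  also have "\<dots> \<le> (\<Sum>k = 1..<n. 1 / real k)"
  proof (rule sum_mono)
    fix k assume "k \<in> {1..<n}"
    hence k: "real k \<ge> 1" by simp
    have "real k \<le> real k ^ p" using k assms by (intro self_le_power) auto
    thus "norm (w ^ k / of_nat k ^ p) \<le> 1 / real k"
      using k assms by (simp add: norm_divide norm_power frac_le)
  qed
  also have "\<dots> \<le> (\<Sum>k = 1..n. 1 / real k)"
    by (intro sum_mono2) auto
  finally show ?thesis using sum_inverse_le_sqrt[of n] by linarith
qed

lemma summable_sqrt_div_square: "summable (\<lambda>n. sqrt (real (Suc n)) / real (Suc n) ^ 2)"
proof -
  have "summable (\<lambda>n. real n powr (-3/2))"
    by (simp add: summable_real_powr_iff)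
  hence "summable (\<lambda>n. real (Suc n) powr (-3/2))"
    by (subst summable_Suc_iff)
  moreover have "real (Suc n) powr (-3/2) = sqrt (real (Suc n)) / real (Suc n) ^ 2" for n
  proof -
    have "real (Suc n) powr (-3/2) = real (Suc n) powr (1/2 - 2)" by simp
    also have "\<dots> = sqrt (real (Suc n)) / real (Suc n) ^ 2"
      unfolding powr_diff by (simp add: powr_half_sqrt)
    finally show ?thesis .
  qed
  ultimately show ?thesis by simp
qed

text \<open>Abel summation: (1 - z) z^n b(n) is the telescoping difference z^n b(n) - z^(n+1) b(n+1)
  plus z^(n+1) (b(n+1) - b(n)). The first part converges since b tends to 0, the second absolutely
  by bounded variation; \<open>z \<noteq> 1\<close> permits the division.\<close>

lemma summable_unit_powers_mult:
  fixes z :: complex and b :: "nat \<Rightarrow> complex"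
  assumes z: "norm z = 1" "z \<noteq> 1" and b: "b \<longlonglongrightarrow> 0"
    and var: "summable (\<lambda>n. norm (b (Suc n) - b n))"
  shows "summable (\<lambda>n. z ^ n * b n)"
proof -
  have "(\<lambda>n. z ^ n * b n) \<longlonglongrightarrow> 0"
    using tendsto_norm_zero[OF b] z
    by (subst tendsto_norm_zero_iff [symmetric]) (simp add: norm_mult norm_power)
  hence "summable (\<lambda>n. z ^ n * b n - z ^ Suc n * b (Suc n))"
    by (rule telescope_summable')
  moreover have "summable (\<lambda>n. z ^ Suc n * (b (Suc n) - b n))"
    using var z
    by (subst summable_norm_cancel) (simp_all add: norm_mult norm_power)
  ultimately have "summable (\<lambda>n. ((z ^ n * b n - z ^ Suc n * b (Suc n)) +
      z ^ Suc n * (b (Suc n) - b n)) / (1 - z))"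
    by (intro summable_divide summable_add)
  moreover have "((z ^ n * b n - z ^ Suc n * b (Suc n)) +
      z ^ Suc n * (b (Suc n) - b n)) / (1 - z) = z ^ n * b n" for n
    using z by (simp add: field_simps)
  ultimately show ?thesis by (simp only:)
qed

lemma summable_double_polylog_abs:
  assumes "norm z = 1" "norm w = 1" "p \<ge> 1" "q \<ge> 2"
  shows "summable (\<lambda>n. z ^ Suc n * polylog_partial p w (Suc n) / of_nat (Suc n) ^ q)"
proof (rule summable_comparison_test')
  show "summable (\<lambda>n. 2 * (sqrt (real (Suc n)) / real (Suc n) ^ 2))"
    by (intro summable_mult summable_sqrt_div_square)
  fix n :: nat
  have "real (Suc n) ^ 2 \<le> real (Suc n) ^ q"
    using assms by (intro power_increasing) auto
  hence "norm (polylog_partial p w (Suc n)) / real (Suc n) ^ q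
      \<le> 2 * sqrt (real (Suc n)) / real (Suc n) ^ 2"
    using norm_polylog_partial_le[OF assms(2,3), of "Suc n"] by (intro frac_le) auto
  thus "norm (z ^ Suc n * polylog_partial p w (Suc n) / of_nat (Suc n) ^ q)
      \<le> 2 * (sqrt (real (Suc n)) / real (Suc n) ^ 2)"
    using assms by (simp add: norm_divide norm_mult norm_power del: of_nat_Suc power_Suc)
qed

text \<open>Abel summation with b the inner sum divided by the outer index: b is O(n^(-1/2)), and
  its increments are O(n^(-3/2)).\<close>

lemma summable_double_polylog_cond:
  assumes "norm z = 1" "z \<noteq> 1" "norm w = 1" "p \<ge> 1"
  shows "summable (\<lambda>n. z ^ Suc n * polylog_partial p w (Suc n) / of_nat (Suc n))"
proof -
  define b where "b n = polylog_partial p w (Suc n) / of_nat (Suc n)" for n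
  note bound = norm_polylog_partial_le[OF assms(3,4)]
  have "norm (b n) \<le> 2 / sqrt (real (Suc n))" for n
  proof -
    have "norm (b n) \<le> 2 * sqrt (real (Suc n)) / real (Suc n)"
      using bound[of "Suc n"]
      by (simp add: b_def norm_divide divide_right_mono del: of_nat_Suc)
    also have "\<dots> = 2 / sqrt (real (Suc n))"
      by (simp add: field_simps del: of_nat_Suc)
    finally show ?thesis .
  qed
  moreover have "(\<lambda>n. 2 / sqrt (real (Suc n))) \<longlonglongrightarrow> 0"
    by (intro LIMSEQ_Suc tendsto_divide_0[OF tendsto_const] filterlim_at_top_imp_at_infinity
        filterlim_compose[OF sqrt_at_top filterlim_real_sequentially])
  ultimately have lim: "b \<longlonglongrightarrow> 0"
    by (intro Lim_null_comparison[of b] always_eventually) auto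
  have var: "summable (\<lambda>n. norm (b (Suc n) - b n))"
  proof (rule summable_comparison_test')
    show "summable (\<lambda>n. 3 * (sqrt (real (Suc n)) / real (Suc n) ^ 2))"
      by (intro summable_mult summable_sqrt_div_square)
    fix n :: nat
    define x where "x = real (Suc n)"
    define a where "a = polylog_partial p w (Suc n)"
    define c where "c = w ^ Suc n / of_nat (Suc n) ^ p"
    have x: "x \<ge> 1" "(of_nat (Suc n) :: complex) = of_real x" by (auto simp: x_def)
    have x1: "1 + complex_of_real x = complex_of_real (1 + x)" by simp
    have cx: "complex_of_real x \<noteq> 0" "1 + complex_of_real x \<noteq> 0"
      unfolding x1 of_real_eq_0_iff using x by auto
    have "x \<le> x ^ p" using x assms by (intro self_le_power) auto
    hence c: "norm c \<le> 1 / x"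
      using x assms unfolding c_def x(2)
      by (simp add: norm_divide norm_power frac_le del: power_Suc)
    have "b (Suc n) - b n = (a + c) / (1 + of_real x) - a / of_real x"
      using x(2) by (simp add: b_def polylog_partial_Suc[of "Suc n"] a_def c_def del: power_Suc)
    \<comment> \<open>The new inner term c has the single denominator 1 + x; the old sum a collects
      1/x - 1/(1 + x) = 1/(x (1 + x)).\<close>
    also have "\<dots> = c / (1 + of_real x) - a / (of_real x * (1 + of_real x))"
      using cx by (simp add: divide_simps) (simp add: algebra_simps)
    also have "norm \<dots> \<le> norm c / (1 + x) + norm a / (x * (1 + x))"
    proof -
      have "norm (1 + complex_of_real x) = 1 + x"
        unfolding x1 norm_of_real using x by simp
      thus ?thesis
        using x norm_triangle_ineq4[of "c / (1 + of_real x)" "a / (of_real x * (1 + of_real x))"]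
        by (simp add: norm_divide norm_mult)
    qed
    also have "\<dots> \<le> (1 / x) / x + (2 * sqrt x) / (x * x)"
      using c x bound[of "Suc n"]
      by (intro add_mono frac_le mult_mono) (auto simp: a_def x_def)
    \<comment> \<open>Since 1 \<le> sqrt x, both summands take the shape sqrt x / x^2, with
      constants 1 and 2; hence the 3.\<close>
    also have "\<dots> \<le> sqrt x / (x * x) + (2 * sqrt x) / (x * x)"
      using x by (intro add_right_mono) (simp add: divide_right_mono)
    also have "\<dots> = 3 * (sqrt x / x ^ 2)"
      using x by (simp add: field_simps power2_eq_square)
    finally show "norm (norm (b (Suc n) - b n)) \<le> 3 * (sqrt (real (Suc n)) / real (Suc n) ^ 2)"
      by (simp add: x_def)
  qed
  have "summable (\<lambda>n. z * (z ^ n * b n))"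
    by (intro summable_mult summable_unit_powers_mult assms lim var)
  thus ?thesis by (simp add: b_def mult.assoc)
qed

section \<open>The level-four combination, term by term\<close>

lemma omega4_eq: "omega4 = \<i>"
  by (simp add: omega4_def complex_eq_iff Re_exp Im_exp)

lemma L4_term_eq:
  "L4_term q p r1 r2 n = (\<i> ^ r1) ^ n * polylog_partial p (\<i> ^ r2) n / of_nat n ^ q"
  unfolding L4_term_def omega4_eq polylog_partial_def sum_distrib_left sum_divide_distrib power_mult
  by (simp add: mult.commute)

lemma summable_L4_term:
  assumes "p \<ge> 1" "q \<ge> 1" "q \<noteq> 1 \<or> \<i> ^ r1 \<noteq> 1"
  shows "summable (\<lambda>n. L4_term q p r1 r2 (Suc n))"
proof (cases "q = 1")
  case True
  thus ?thesis
    using summable_double_polylog_cond[of "\<i> ^ r1" "\<i> ^ r2" p] assms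
    by (simp add: L4_term_eq norm_power)
next
  case False
  thus ?thesis
    unfolding L4_term_eq using assms
    by (intro summable_double_polylog_abs) (auto simp: norm_power)
qed

text \<open>The bound \<open>Suc (2 * m)\<close> is the odd outer index n1, so the inner indices run
  up to 2m and the surviving halves up to m.\<close>

lemma sum_even_terms:
  fixes f :: "nat \<Rightarrow> 'a::comm_monoid_add"
  assumes "\<And>k. odd k \<Longrightarrow> f k = 0"
  shows "(\<Sum>k = 1..<Suc (2 * m). f k) = (\<Sum>k = 1..m. f (2 * k))"
proof (induction m)
  case (Suc m)
  have "{1..<Suc (2 * Suc m)} = insert (Suc (2 * m)) (insert (2 * Suc m) {1..<Suc (2 * m)})"
    by auto
  thus ?case using Suc assms[of "Suc (2 * m)"]
    by (simp add: add.commute)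
qed simp

lemma i_power_double: "\<i> ^ (2 * n) = (-1) ^ n"
  by (simp add: power_mult)

text \<open>The sum w^k + (-w)^k vanishes for odd k and is 2 w^k for even k; halving k extracts 2^p
  from the denominator.\<close>

lemma polylog_partial_even_part:
  "polylog_partial p w (Suc (2 * m)) + polylog_partial p (- w) (Suc (2 * m)) =
     2 / 2 ^ p * (\<Sum>k = 1..m. (w ^ 2) ^ k / of_nat k ^ p)"
proof -
  have "polylog_partial p w (Suc (2 * m)) + polylog_partial p (- w) (Suc (2 * m)) =
      (\<Sum>k = 1..<Suc (2 * m). (w ^ k + (- w) ^ k) / of_nat k ^ p)"
    by (simp only: polylog_partial_def sum.distrib [symmetric] add_divide_distrib)
  also have "\<dots> = (\<Sum>k = 1..m. (w ^ (2 * k) + (- w) ^ (2 * k)) / of_nat (2 * k) ^ p)"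
    by (rule sum_even_terms) simp
  finally show ?thesis
    by (simp add: sum_distrib_left power_mult power_mult_distrib)
qed

text \<open>Adding 2 to an exponent negates the power of \<i>. For odd n the two subtracted terms
  therefore repeat the first two, and shifting the inner exponent pairs w with -w. Each effect
  contributes a factor 2, completing 2^(p+q-2) to 2^(p+q).\<close>

lemma L4_term_combination_odd:
  fixes m :: nat
  assumes "\<sigma>1 \<in> {1, -1}" "\<sigma>2 \<in> {1, -1}" "p \<ge> 1" "q \<ge> 1"
  defines "l1 \<equiv> sign_exp \<sigma>1" and "l2 \<equiv> sign_exp \<sigma>2" and "n \<equiv> Suc (2 * m)"
  shows "2 ^ (p + q - 2) * complex_of_real \<sigma>1 * sign_pow_3_2 \<sigma>2 *
      (L4_term q p l2 l1 n + L4_term q p l2 (l1 + 2) n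
       - L4_term q p (l2 + 2) l1 n - L4_term q p (l2 + 2) (l1 + 2) n)
    = complex_of_real (euler_R_term p q \<sigma>1 \<sigma>2 (Suc m))"
proof -
  have w: "(\<i> ^ l1) ^ 2 = complex_of_real \<sigma>1"
    using assms by (auto simp: sign_exp_def)
  define S where "S = (\<Sum>k = 1..m. complex_of_real \<sigma>1 ^ k / of_nat k ^ p)"
  \<comment> \<open>The prefactor \<open>\<sigma>1\<close> lowers the exponent from k to k - 1, as
    its square is 1.\<close>
  have S: "complex_of_real \<sigma>1 * S = complex_of_real (alt_harm p m \<sigma>1)"
  proof -
    have "complex_of_real \<sigma>1 * (complex_of_real \<sigma>1 ^ k / of_nat k ^ p) =
        complex_of_real (\<sigma>1 ^ (k - 1) / real k ^ p)" if "k \<in> {1..m}" for k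
      using that assms(1) by (cases k) auto
    thus ?thesis by (simp add: S_def alt_harm_def sum_distrib_left)
  qed
  \<comment> \<open>As n = 2m + 1, the outer power is \<open>\<sigma>2 ^ m\<close> times
    \<open>\<i> ^ l2\<close>, and the branch of the 3/2 power is the inverse of
    \<open>\<i> ^ l2\<close>.\<close>
  have z: "sign_pow_3_2 \<sigma>2 * (\<i> ^ l2) ^ n = complex_of_real (\<sigma>2 ^ m)"
  proof -
    have "exp (3 * complex_of_real pi * \<i> / 2) = - \<i>"
    proof -
      have "3 * pi / 2 = 3 / 2 * pi" by simp
      hence "cos (3 * pi / 2) = 0" "sin (3 * pi / 2) = - 1"
        by (simp_all only: cos_3over2_pi sin_3over2_pi)
      thus ?thesis by (simp add: complex_eq_iff Re_exp Im_exp)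
    qed
    thus ?thesis using assms(2)
      by (auto simp: sign_pow_3_2_def l2_def sign_exp_def n_def i_power_double)
  qed
  have "L4_term q p l2 l1 n + L4_term q p l2 (l1 + 2) n
       - L4_term q p (l2 + 2) l1 n - L4_term q p (l2 + 2) (l1 + 2) n =
     2 * (\<i> ^ l2) ^ n / of_nat n ^ q *
       (polylog_partial p (\<i> ^ l1) n + polylog_partial p (- (\<i> ^ l1)) n)"
  proof -
    have "odd n" by (simp add: n_def)
    moreover have "\<i> ^ (l + 2) = - (\<i> ^ l)" for l by (simp add: power_add)
    ultimately show ?thesis
      by (simp only: L4_term_eq power_minus_odd divide_inverse) (simp only: algebra_simps, simp)
  qed
  also have "\<dots> = 4 * (\<i> ^ l2) ^ n / (2 ^ p * of_nat n ^ q) * S"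
    unfolding n_def polylog_partial_even_part w S_def by (simp add: ac_simps)
  finally have "2 ^ (p + q - 2) * complex_of_real \<sigma>1 * sign_pow_3_2 \<sigma>2 *
      (L4_term q p l2 l1 n + L4_term q p l2 (l1 + 2) n
       - L4_term q p (l2 + 2) l1 n - L4_term q p (l2 + 2) (l1 + 2) n) =
     (2 ^ (p + q - 2) * 4) / (2 ^ p * of_nat n ^ q) * (sign_pow_3_2 \<sigma>2 * (\<i> ^ l2) ^ n)
       * (complex_of_real \<sigma>1 * S)"
    by (simp only: divide_inverse ac_simps)
  \<comment> \<open>From p, q \<ge> 1 the natural-number subtraction is exact.\<close>
  also have "(2 ^ (p + q - 2) * 4 :: complex) = 2 ^ p * 2 ^ q"
  proof -
    obtain k where "p + q = k + 2"
      using assms(3,4) by (metis add_mono one_add_one le_add_diff_inverse2)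
    thus ?thesis by (simp add: power_add flip: power_add[of _ p q])
  qed
  also have "(2 ^ p * 2 ^ q) / (2 ^ p * of_nat n ^ q) =
      complex_of_real (1 / (real (Suc m) - 1 / 2) ^ q)"
  proof -
    have "real (Suc m) - 1 / 2 = real n / 2"
      by (simp add: n_def field_simps)
    thus ?thesis by (simp only: power_divide) simp
  qed
  finally show ?thesis
    unfolding z S by (simp add: euler_R_term_def)
qed

lemma L4_term_combination_even:
  assumes "even n"
  shows "L4_term q p l2 l1 n + L4_term q p l2 (l1 + 2) n
       - L4_term q p (l2 + 2) l1 n - L4_term q p (l2 + 2) (l1 + 2) n = 0"
  using assms by (simp add: L4_term_eq power_add)

section \<open>From terms to series\<close>

theorem theorem3p12:
  fixes p q :: nat and \<sigma>1 \<sigma>2 :: real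
  assumes "p \<ge> 1" and "q \<ge> 1"
    and "\<sigma>1 \<in> {1, -1}" and "\<sigma>2 \<in> {1, -1}"
    and "(q, \<sigma>2) \<noteq> (1, 1)"
  shows "summable (\<lambda>n. euler_R_term p q \<sigma>1 \<sigma>2 (Suc n)) \<and>
    (\<forall>r1 \<in> {sign_exp \<sigma>2, sign_exp \<sigma>2 + 2}. \<forall>r2 \<in> {sign_exp \<sigma>1, sign_exp \<sigma>1 + 2}.
       summable (\<lambda>n. L4_term q p r1 r2 (Suc n))) \<and>
    complex_of_real (euler_R p q \<sigma>1 \<sigma>2) =
      2 ^ (p + q - 2) * complex_of_real \<sigma>1 * sign_pow_3_2 \<sigma>2 *
      (L4 q p (sign_exp \<sigma>2) (sign_exp \<sigma>1) + L4 q p (sign_exp \<sigma>2) (sign_exp \<sigma>1 + 2)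
       - L4 q p (sign_exp \<sigma>2 + 2) (sign_exp \<sigma>1) - L4 q p (sign_exp \<sigma>2 + 2) (sign_exp \<sigma>1 + 2))"
proof -
  define l1 l2 where "l1 = sign_exp \<sigma>1" and "l2 = sign_exp \<sigma>2"
  \<comment> \<open>For q = 1 the hypothesis forces \<open>\<sigma>2\<close> = -1, so r1 is 1 or 3
    and the outer root of unity is \<i> or -\<i>.\<close>
  have "q \<noteq> 1 \<or> \<i> ^ r1 \<noteq> 1" if "r1 \<in> {l2, l2 + 2}" for r1
    using that assms(4,5) by (auto simp: l2_def sign_exp_def complex_eq_iff)
  hence summ: "summable (\<lambda>n. L4_term q p r1 r2 (Suc n))" if "r1 \<in> {l2, l2 + 2}" for r1 r2
    using that assms(1,2) summable_L4_term by blast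
  hence L4: "(\<lambda>n. L4_term q p r1 r2 (Suc n)) sums L4 q p r1 r2" if "r1 \<in> {l2, l2 + 2}" for r1 r2
    using that unfolding L4_def by blast
  define C where "C = 2 ^ (p + q - 2) * complex_of_real \<sigma>1 * sign_pow_3_2 \<sigma>2"
  define T where "T n = C * (L4_term q p l2 l1 n + L4_term q p l2 (l1 + 2) n
       - L4_term q p (l2 + 2) l1 n - L4_term q p (l2 + 2) (l1 + 2) n)" for n
  define V where "V = C * (L4 q p l2 l1 + L4 q p l2 (l1 + 2)
       - L4 q p (l2 + 2) l1 - L4 q p (l2 + 2) (l1 + 2))"
  have "(\<lambda>n. T (Suc n)) sums V"
    unfolding T_def V_def by (intro sums_mult sums_add sums_diff L4) auto
  \<comment> \<open>The series index n stands for n1 = n + 1, so the odd n are the vanishing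
    ones.\<close>
  moreover have "T (Suc n) = 0" if "n \<notin> range (\<lambda>m. 2 * m)" for n
  proof -
    have "even (Suc n)" using that by (auto elim!: evenE)
    thus ?thesis unfolding T_def by (simp only: L4_term_combination_even mult_zero_right)
  qed
  \<comment> \<open>Only zero terms are dropped and the order is kept, so this is valid for
    conditional convergence too.\<close>
  ultimately have "(\<lambda>m. T (Suc (2 * m))) sums V"
    by (subst sums_mono_reindex[where g = "\<lambda>m. 2 * m"]) (auto simp: strict_mono_def)
  moreover have "T (Suc (2 * m)) = complex_of_real (euler_R_term p q \<sigma>1 \<sigma>2 (Suc m))" for m
    unfolding T_def C_def l1_def l2_def using assms by (intro L4_term_combination_odd)
  ultimately have R: "(\<lambda>m. complex_of_real (euler_R_term p q \<sigma>1 \<sigma>2 (Suc m))) sums V"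
    by simp
  \<comment> \<open>Real summability comes from the real parts of the complex series, so convergence
    of the R-sum is a consequence of that of the four \<open>L4\<close> series.\<close>
  hence Rs: "summable (\<lambda>m. euler_R_term p q \<sigma>1 \<sigma>2 (Suc m))"
    using sums_Re by (fastforce dest: sums_summable)
  hence "(\<lambda>m. complex_of_real (euler_R_term p q \<sigma>1 \<sigma>2 (Suc m))) sums
      complex_of_real (euler_R p q \<sigma>1 \<sigma>2)"
    unfolding euler_R_def by (intro sums_of_real summable_sums)
  with R have "complex_of_real (euler_R p q \<sigma>1 \<sigma>2) = V"
    using sums_unique2 by blast
  thus ?thesis using Rs summ by (simp add: V_def C_def l1_def l2_def)
qed

end
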